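(* Let $N\ge3$ and $p_0,p_1,p_2,p_3\in[0,1]$, and assume that the Markov chain in $\Sigma$ with one-step transition matrix $\boldsymbol P$ is ergodic, with unique stationary distribution $\boldsymbol\pi$. Let $\hat S_t$ be the cumulative profit at time $t$ to the ensemble of $N$ players, assuming the continuous-time Markov chain model in $\Sigma^*$ with infinitesimal matrix $\boldsymbol Q^*:=\boldsymbol P^*-\boldsymbol I$. Then $\lim_{t\to\infty}t^{-1}\hat S_t=\mu^N$ a.s., where $$\mu^N=\frac1N\sum_{\boldsymbol x\in\Sigma}\pi(\boldsymbol x)\sum_{i=1}^N[p_{m_i(\boldsymbol x)}-q_{m_i(\boldsymbol x)}].$$
   Context: Put $q_m:=1-p_m$. $\Sigma:=\{0,1\}^N$; for $\boldsymbol x\in\Sigma$ indices are cyclic ($x_0:=x_N$, $x_{N+1}:=x_1$), $m_i(\boldsymbol x):=2x_{i-1}+x_{i+1}$, and $\boldsymbol x^i$ is $\boldsymbol x$ with the $i$th component replaced by $1-x_i$. $\boldsymbol P$ is given by $P(\boldsymbol x,\boldsymbol x^i)=N^{-1}p_{m_i(\boldsymbol x)}$ if $x_i=0$, $P(\boldsymbol x,\boldsymbol x^i)=N^{-1}q_{m_i(\boldsymbol x)}$ if $x_i=1$ ($i=1,\dots,N$), $P(\boldsymbol x,\boldsymbol x)=N^{-1}\big(\sum_{i:x_i=0}q_{m_i(\boldsymbol x)}+\sum_{i:x_i=1}p_{m_i(\boldsymbol x)}\big)$, and $P(\boldsymbol x,\boldsymbol y)=0$ otherwise. The chain is ergodic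 if it has a unique stationary distribution and the distribution at time $n$ converges to it as $n\to\infty$, whatever the initial distribution. $\Sigma^*:=\Sigma\times\{1,\dots,N\}$. For all $(\boldsymbol x,i)\in\Sigma^*$ and $j=1,\dots,N$: $P^*((\boldsymbol x,i),(\boldsymbol x^i,j))=N^{-1}p_{m_i(\boldsymbol x)}$ if $x_i=0$ and $N^{-1}q_{m_i(\boldsymbol x)}$ if $x_i=1$; $P^*((\boldsymbol x,i),(\boldsymbol x,j))=N^{-1}q_{m_i(\boldsymbol x)}$ if $x_i=0$ and $N^{-1}p_{m_i(\boldsymbol x)}$ if $x_i=1$; all other entries are 0. A transition from $(\boldsymbol x,i)$ to $(\boldsymbol y,j)$ gives the ensemble a profit of $1$ if $y_i=1$ (player $i$ wins) and $-1$ if $y_i=0$ (player $i$ loses). The continuous-time model is realized as $\boldsymbol Y^*(t):=\boldsymbol X^*(N(t))$, where $\{\boldsymbol X^*(n)\}_{n\ge0}$ is the discrete-time Markov chain in $\Sigma^*$ with one-step transition matrix $\boldsymbol P^*$ (arbitrary initial distribution) and $\{N(t)\}$ is an independent rate 1 Poisson process. Jumps from a state to itself are counted as jumps, and the cumulative profit at time $t$ is $\hat S_t:=S_{N(t)}$, where $S_n$ is the sum of the profits from the first $n$ transitions of $\{\boldsymbol X^*(n)\}$. *)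

theory Defs
  imports "HOL-Probability.Probability"
begin

type_synonym config = "nat \<Rightarrow> nat"

definition configs :: "nat \<Rightarrow> config set" where
  "configs N = PiE {1..N} (\<lambda>_. {0, 1})"

definition left :: "nat \<Rightarrow> nat \<Rightarrow> nat" where
  "left N i = (if i = 1 then N else i - 1)"

definition right :: "nat \<Rightarrow> nat \<Rightarrow> nat" where
  "right N i = (if i = N then 1 else i + 1)"

definition nbhd :: "nat \<Rightarrow> config \<Rightarrow> nat \<Rightarrow> nat" where
  "nbhd N x i = 2 * x (left N i) + x (right N i)"

definition flip :: "config \<Rightarrow> nat \<Rightarrow> config" where
  "flip x i = x(i := 1 - x i)"

(* The coins are given by p :: nat => real; only p 0, ..., p 3 are ever used.
   For x in configs N the configurations flip x i (i = 1..N) are distinct from each other and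
   from x, so at most one term of the off-diagonal sum is nonzero, and the sum is 0 unless y
   is some flip x i. *)
definition P :: "nat \<Rightarrow> (nat \<Rightarrow> real) \<Rightarrow> config \<Rightarrow> config \<Rightarrow> real" where
  "P N p x y =
    (if y = x then
       1 / real N * ((\<Sum>i\<in>{i\<in>{1..N}. x i = 0}. 1 - p (nbhd N x i)) +
                     (\<Sum>i\<in>{i\<in>{1..N}. x i = 1}. p (nbhd N x i)))
     else
       (\<Sum>i\<in>{i\<in>{1..N}. y = flip x i}.
          1 / real N * (if x i = 0 then p (nbhd N x i) else 1 - p (nbhd N x i))))"

(* A state (x, i) records the configuration x and the player i who plays next. *)
definition states_star :: "nat \<Rightarrow> (config \<times> nat) set" where
  "states_star N = configs N \<times> {1..N}"

definition P_star :: "nat \<Rightarrow> (nat \<Rightarrow> real) \<Rightarrow> config \<times> nat \<Rightarrow> config \<times> nat \<Rightarrow> real" where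
  "P_star N p = (\<lambda>(x, i) (y, j).
     if y = flip x i then
       1 / real N * (if x i = 0 then p (nbhd N x i) else 1 - p (nbhd N x i))
     else if y = x then
       1 / real N * (if x i = 0 then 1 - p (nbhd N x i) else p (nbhd N x i))
     else 0)"

text \<open>Finite Markov chains given by a state space \<open>S\<close> and a transition matrix \<open>K\<close>.\<close>

definition stationary :: "'s set \<Rightarrow> ('s \<Rightarrow> 's \<Rightarrow> real) \<Rightarrow> 's pmf \<Rightarrow> bool" where
  "stationary S K \<pi> \<longleftrightarrow>
     set_pmf \<pi> \<subseteq> S \<and> (\<forall>y\<in>S. (\<Sum>x\<in>S. pmf \<pi> x * K x y) = pmf \<pi> y)"

primrec dist_at :: "'s set \<Rightarrow> ('s \<Rightarrow> 's \<Rightarrow> real) \<Rightarrow> 's pmf \<Rightarrow> nat \<Rightarrow> 's \<Rightarrow> real" where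
  "dist_at S K \<nu> 0 y = pmf \<nu> y"
| "dist_at S K \<nu> (Suc n) y = (\<Sum>x\<in>S. dist_at S K \<nu> n x * K x y)"

definition ergodic :: "'s set \<Rightarrow> ('s \<Rightarrow> 's \<Rightarrow> real) \<Rightarrow> bool" where
  "ergodic S K \<longleftrightarrow>
     (\<exists>\<pi>. stationary S K \<pi> \<and> (\<forall>\<pi>'. stationary S K \<pi>' \<longrightarrow> \<pi>' = \<pi>) \<and>
       (\<forall>\<nu>. set_pmf \<nu> \<subseteq> S \<longrightarrow> (\<forall>x\<in>S. (\<lambda>n. dist_at S K \<nu> n x) \<longlonglongrightarrow> pmf \<pi> x)))"

(* The Markov property is stated in product form, which also covers histories of probability 0.
   The distribution of X 0 is unrestricted. *)
locale markov_chain = prob_space M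
  for M :: "'w measure" and S :: "'s set" and K :: "'s \<Rightarrow> 's \<Rightarrow> real" and X :: "nat \<Rightarrow> 'w \<Rightarrow> 's" +
  assumes measurable_X: "X n \<in> measurable M (count_space S)"
    and transition: "(\<forall>k\<le>Suc n. s k \<in> S) \<Longrightarrow>
      prob {w \<in> space M. \<forall>k\<le>Suc n. X k w = s k} =
      prob {w \<in> space M. \<forall>k\<le>n. X k w = s k} * K (s n) (s (Suc n))"

(* C t is used for t \<ge> 0 only. Since paths are nondecreasing, the truncated subtraction on nat
   is genuine subtraction, almost surely. *)
locale poisson_process = prob_space M
  for M :: "'w measure" and rate :: real and C :: "real \<Rightarrow> 'w \<Rightarrow> nat" +
  assumes measurable_C: "0 \<le> t \<Longrightarrow> C t \<in> measurable M (count_space UNIV)"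
    and counting_paths: "AE w in M. C 0 w = 0 \<and> mono_on {0..} (\<lambda>t. C t w) \<and>
      (\<forall>t\<ge>0. continuous (at_right t) (\<lambda>u. C u w))"
    and increments: "0 \<le> s \<Longrightarrow> s < t \<Longrightarrow>
      distr M (count_space UNIV) (\<lambda>w. C t w - C s w) = measure_pmf (poisson_pmf (rate * (t - s)))"
    and indep_increments: "0 \<le> \<tau> 0 \<Longrightarrow> strict_mono \<tau> \<Longrightarrow>
      indep_vars (\<lambda>_. count_space UNIV) (\<lambda>k w. C (\<tau> (Suc k)) w - C (\<tau> k) w) {..<n :: nat}"

(* The continuous-time chain is Y t = X (C t), with infinitesimal matrix K - I. It is represented
   by the pair (X, C) because jumps from a state to itself, invisible in Y, count as jumps.
   Independence is that of the sigma-algebras generated by the whole processes X and C. *)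
locale uniformized_chain = markov_chain M S K X + poisson_process M 1 C
  for M :: "'w measure" and S :: "'s set" and K :: "'s \<Rightarrow> 's \<Rightarrow> real"
    and X :: "nat \<Rightarrow> 'w \<Rightarrow> 's" and C :: "real \<Rightarrow> 'w \<Rightarrow> nat" +
  assumes indep_X_C: "indep_set
      (sigma_sets (space M) {X n -` A \<inter> space M | n A. A \<subseteq> S})
      (sigma_sets (space M) {C t -` A \<inter> space M | t A. 0 \<le> t})"

definition profit :: "config \<times> nat \<Rightarrow> config \<times> nat \<Rightarrow> real" where
  "profit = (\<lambda>(x, i) (y, j). if y i = 1 then 1 else - 1)"

definition cum_profit :: "(nat \<Rightarrow> 'w \<Rightarrow> config \<times> nat) \<Rightarrow> nat \<Rightarrow> 'w \<Rightarrow> real" where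
  "cum_profit X n w = (\<Sum>k<n. profit (X k w) (X (Suc k) w))"

definition cum_profit_ct ::
  "(nat \<Rightarrow> 'w \<Rightarrow> config \<times> nat) \<Rightarrow> (real \<Rightarrow> 'w \<Rightarrow> nat) \<Rightarrow> real \<Rightarrow> 'w \<Rightarrow> real" where
  "cum_profit_ct X C t w = cum_profit X (C t w) w"

end

theory Submission
  imports Defs
begin

text \<open>
  Write \<open>S\<^sub>n\<close> for the profit from the first \<open>n\<close> jumps and \<open>C\<^sub>t\<close> for the number of jumps up to
  time \<open>t\<close>. The profit at time \<open>t\<close>, divided by \<open>t\<close>, is the product of \<open>S\<^sub>n / n\<close> at \<open>n = C\<^sub>t\<close> with \<open>C\<^sub>t / t\<close>, so it is enough
  that \<open>C\<^sub>t / t\<close> tends to 1 and \<open>S\<^sub>n / n\<close> tends to \<open>\<mu>\<close>, each almost surely. Both facts have the same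
  source: the variance grows linearly, hence along the perfect squares the normalized second
  moments are summable and force almost sure convergence (\<open>AE_tendsto_0_along_squares\<close>), and a
  monotone function cannot escape between consecutive squares
  (\<open>mono_ratio_tendsto_from_squares\<close>). For \<open>C\<close> the linear growth is the fact that the
  variance of a Poisson variable equals its mean (\<open>poisson_variance\<close>).

  For the profits, linear growth of the variance would follow if they were uncorrelated, which they are
  not. Let \<open>T\<close> be the operator of the chain \<open>X\<close>, and let \<open>f z\<close> be the mean profit of a jump
  out of \<open>z\<close>. With \<open>h = f + T f + \<dots> + T\<^bsup>m-1\<^esup> f\<close>, an approximate solution of the Poisson equation,
  the sum of the profits differs from a sum of martingale differences by a telescoping sum of values
  of \<open>h\<close> and by the sum of \<open>T\<^sup>m f\<close> along the path. The martingale differences are orthogonal and obey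
  the strong law, the telescoping part is bounded, and the last part is within \<open>\<epsilon> n\<close> of \<open>\<mu> n\<close> as soon
  as \<open>T\<^sup>m f\<close> is within \<open>\<epsilon>\<close> of \<open>\<mu>\<close> (\<open>strong_law_transitions\<close>). Fixing \<open>m\<close> first and
  letting it grow afterwards avoids an exact solution of the Poisson equation, whose existence would
  call for a rate of convergence of \<open>T\<^sup>m f\<close> or for linear algebra.

  Ergodicity is assumed for the chain of configurations, whereas \<open>X\<close> also records the next player.
  Averaging over that player intertwines the two operators (\<open>player_average_kernel_op\<close>), and one
  step of \<open>X\<close> from \<open>(x, i)\<close> sees its target function only through this average, since the next
  player is uniform. So the powers of \<open>T\<close> converge to the stationary mean of the averages, and the
  average of \<open>f\<close> over the players turns this mean into \<open>\<mu>\<close>.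
\<close>

section \<open>Almost sure convergence along the squares\<close>

text \<open>
  By monotone convergence the series of squares has a finite integral, so it converges almost surely
  and its terms tend to 0. This takes the place of Chebyshev's inequality with the Borel-Cantelli
  lemma.
\<close>

lemma AE_tendsto_0_if_summable_second_moments:
  fixes Z :: "nat \<Rightarrow> 'w \<Rightarrow> real"
  assumes meas: "\<And>k. Z k \<in> borel_measurable M"
    and bound: "\<And>k. (\<integral>\<^sup>+ w. ennreal ((Z k w)\<^sup>2) \<partial>M) \<le> ennreal (c k)"
    and c: "\<And>k. 0 \<le> c k" "summable c"
  shows "AE w in M. (\<lambda>k. Z k w) \<longlonglongrightarrow> 0"
proof -
  have "(\<integral>\<^sup>+ w. (\<Sum>k. ennreal ((Z k w)\<^sup>2)) \<partial>M) = (\<Sum>k. \<integral>\<^sup>+ w. ennreal ((Z k w)\<^sup>2) \<partial>M)"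
    using meas by (intro nn_integral_suminf) auto
  also have "\<dots> \<le> (\<Sum>k. ennreal (c k))"
    using bound by (intro suminf_le) auto
  also have "\<dots> = ennreal (\<Sum>k. c k)"
    using c by (intro suminf_ennreal2)
  also have "\<dots> < \<infinity>"
    by simp
  finally have "AE w in M. (\<Sum>k. ennreal ((Z k w)\<^sup>2)) \<noteq> \<infinity>"
    using meas by (intro nn_integral_PInf_AE) auto
  then show ?thesis
  proof (rule AE_mp, intro AE_I2 impI)
    fix w assume "(\<Sum>k. ennreal ((Z k w)\<^sup>2)) \<noteq> \<infinity>"
    then have "summable (\<lambda>k. (Z k w)\<^sup>2)"
      by (intro summable_suminf_not_top) auto
    then have "(\<lambda>k. sqrt ((Z k w)\<^sup>2)) \<longlonglongrightarrow> sqrt 0"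
      by (intro tendsto_real_sqrt summable_LIMSEQ_zero)
    then show "(\<lambda>k. Z k w) \<longlonglongrightarrow> 0"
      by (simp add: tendsto_rabs_zero_iff)
  qed
qed

text \<open>
  \<open>Y\<^sub>k\<close> stands for a centred process observed at time \<open>k\<^sup>2\<close>. A second moment linear in time becomes, after
  division by \<open>k\<^sup>4\<close>, of order \<open>1 / k\<^sup>2\<close> and hence summable; along all integers it would only be of order
  \<open>1 / k\<close>.
\<close>

lemma AE_tendsto_0_along_squares:
  fixes Y :: "nat \<Rightarrow> 'w \<Rightarrow> real"
  assumes meas: "\<And>k. Y k \<in> borel_measurable M"
    and bound: "\<And>k. (\<integral>\<^sup>+ w. ennreal ((Y k w)\<^sup>2) \<partial>M) \<le> ennreal (r * (real k)\<^sup>2)"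
    and r: "0 \<le> r"
  shows "AE w in M. (\<lambda>k. Y k w / (real k)\<^sup>2) \<longlonglongrightarrow> 0"
proof (rule AE_tendsto_0_if_summable_second_moments)
  fix k
  show "(\<lambda>w. Y k w / (real k)\<^sup>2) \<in> borel_measurable M"
    using meas by measurable
  have "(y / (real k)\<^sup>2)\<^sup>2 = inverse (real k ^ 4) * y\<^sup>2" for y
    by (simp add: divide_inverse power_mult_distrib power_inverse mult.commute flip: power_mult)
  then have "(\<integral>\<^sup>+ w. ennreal ((Y k w / (real k)\<^sup>2)\<^sup>2) \<partial>M)
      = ennreal (inverse (real k ^ 4)) * (\<integral>\<^sup>+ w. ennreal ((Y k w)\<^sup>2) \<partial>M)"
    using meas by (subst nn_integral_cmult[symmetric]) (auto simp: ennreal_mult)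
  also have "\<dots> \<le> ennreal (inverse (real k ^ 4)) * ennreal (r * (real k)\<^sup>2)"
    by (intro mult_left_mono bound) simp
  also have "\<dots> = ennreal (inverse (real k ^ 4) * (r * (real k)\<^sup>2))"
    using r by (intro ennreal_mult[symmetric]) auto
  also have "inverse (real k ^ 4) * (r * (real k)\<^sup>2) = r * inverse (real k ^ 2)"
    by (simp add: field_simps eval_nat_numeral)
  finally show "(\<integral>\<^sup>+ w. ennreal ((Y k w / (real k)\<^sup>2)\<^sup>2) \<partial>M) \<le> ennreal (r * inverse (real k ^ 2))" .
next
  show "0 \<le> r * inverse (real k ^ 2)" for k
    using r by simp
  show "summable (\<lambda>k. r * inverse (real k ^ 2))"
    by (intro summable_mult inverse_power_summable) simp
qed

text \<open>
  If \<open>k\<^sup>2 \<le> t \<le> (k + 1)\<^sup>2\<close>, then monotonicity traps \<open>a t / t\<close> between \<open>a (k\<^sup>2) / (k + 1)\<^sup>2\<close> and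
  \<open>a ((k + 1)\<^sup>2) / k\<^sup>2\<close>, and consecutive squares have ratio tending to 1.
\<close>

lemma mono_ratio_tendsto_from_squares:
  fixes a :: "real \<Rightarrow> real"
  assumes mono: "mono_on {0..} a" and nonneg: "0 \<le> a 0"
    and lim: "(\<lambda>k::nat. a ((real k)\<^sup>2) / (real k)\<^sup>2) \<longlonglongrightarrow> c"
  shows "((\<lambda>t. a t / t) \<longlongrightarrow> c) at_top"
proof -
  define r where "r k = a ((real k)\<^sup>2) / (real k)\<^sup>2" for k :: nat
  define l where "l k = r k * (real k / real (Suc k))\<^sup>2" for k
  define u where "u k = r (Suc k) * (real (Suc k) / real k)\<^sup>2" for k
  define root_floor where "root_floor t = nat \<lfloor>sqrt t\<rfloor>" for t :: real
  have r: "r \<longlonglongrightarrow> c" "(\<lambda>k. r (Suc k)) \<longlonglongrightarrow> c"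
    using lim LIMSEQ_Suc[of r c] by (simp_all add: r_def[abs_def])
  have l: "l \<longlonglongrightarrow> c * 1\<^sup>2"
    unfolding l_def[abs_def] by (intro tendsto_mult tendsto_power r LIMSEQ_n_over_Suc_n)
  have u: "u \<longlonglongrightarrow> c * 1\<^sup>2"
    unfolding u_def[abs_def] by (intro tendsto_mult tendsto_power r LIMSEQ_Suc_n_over_n)
  have root_floor: "filterlim root_floor sequentially at_top"
    unfolding root_floor_def[abs_def]
    by (intro filterlim_compose[OF filterlim_nat_sequentially]
        filterlim_compose[OF filterlim_floor_sequentially] sqrt_at_top)
  have lims: "((\<lambda>t. l (root_floor t)) \<longlongrightarrow> c) at_top"
      "((\<lambda>t. u (root_floor t)) \<longlongrightarrow> c) at_top"
    using filterlim_compose[OF l root_floor] filterlim_compose[OF u root_floor] by simp_all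
  have sandwich: "l (root_floor t) \<le> a t / t \<and> a t / t \<le> u (root_floor t)" if "1 \<le> t" for t
  proof -
    define k where "k = root_floor t"
    have k: "1 \<le> real k" "real k \<le> sqrt t" "sqrt t \<le> real (Suc k)"
      using that unfolding k_def root_floor_def
      by (simp_all add: le_nat_iff le_floor_iff) linarith+
    have sq: "(real k)\<^sup>2 \<le> t" "t \<le> (real (Suc k))\<^sup>2"
      using k that power_mono[of "real k" "sqrt t" 2] power_mono[of "sqrt t" "real (Suc k)" 2] by auto
    have a: "0 \<le> a ((real k)\<^sup>2)" "a ((real k)\<^sup>2) \<le> a t" "a t \<le> a ((real (Suc k))\<^sup>2)"
      using nonneg mono_onD[OF mono, of 0 "(real k)\<^sup>2"] mono_onD[OF mono, of "(real k)\<^sup>2" t]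
        mono_onD[OF mono, of t "(real (Suc k))\<^sup>2"] sq that by auto
    have "l k = a ((real k)\<^sup>2) / (real (Suc k))\<^sup>2" "u k = a ((real (Suc k))\<^sup>2) / (real k)\<^sup>2"
      using k unfolding l_def u_def r_def by (auto simp: power_divide)
    moreover have "a ((real k)\<^sup>2) / (real (Suc k))\<^sup>2 \<le> a t / t"
      using a sq that by (intro frac_le) auto
    moreover have "a t / t \<le> a ((real (Suc k))\<^sup>2) / (real k)\<^sup>2"
      using a sq k by (intro frac_le) auto
    ultimately show ?thesis
      by (simp add: k_def)
  qed
  show ?thesis
  proof (rule tendsto_sandwich[OF _ _ lims])
    show "\<forall>\<^sub>F t in at_top. l (root_floor t) \<le> a t / t"
      using eventually_ge_at_top[of 1] by (rule eventually_mono) (use sandwich in blast)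
    show "\<forall>\<^sub>F t in at_top. a t / t \<le> u (root_floor t)"
      using eventually_ge_at_top[of 1] by (rule eventually_mono) (use sandwich in blast)
  qed
qed

section \<open>A strong law for bounded orthogonal random variables\<close>

lemma (in prob_space) second_moment_sum_orthogonal_le:
  fixes D :: "nat \<Rightarrow> 'a \<Rightarrow> real"
  assumes meas: "\<And>k. D k \<in> borel_measurable M"
    and bounded: "\<And>k w. w \<in> space M \<Longrightarrow> \<bar>D k w\<bar> \<le> B"
    and orth: "\<And>j k. j < k \<Longrightarrow> expectation (\<lambda>w. D j w * D k w) = 0"
  shows "(\<integral>\<^sup>+ w. ennreal ((\<Sum>k<n. D k w)\<^sup>2) \<partial>M) \<le> ennreal (real n * B\<^sup>2)"
proof -
  have bnd: "\<bar>D j w * D k w\<bar> \<le> B\<^sup>2" if "w \<in> space M" for j k w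
    using mult_mono[OF bounded[OF that] bounded[OF that]] bounded[OF that, of j]
    by (simp add: abs_mult power2_eq_square)
  have int: "integrable M (\<lambda>w. D j w * D k w)" for j k
    by (rule integrable_const_bound[of _ "B\<^sup>2"]) (use bnd meas in auto)
  have square: "(\<Sum>k<n. D k w)\<^sup>2 = (\<Sum>j<n. \<Sum>k<n. D j w * D k w)" for w
    by (simp add: power2_eq_square sum_product)
  have orth': "expectation (\<lambda>w. D j w * D k w) = 0" if "j \<noteq> k" for j k
    using orth[of j k] orth[of k j] that by (cases "j < k") (auto simp: mult.commute)
  have "expectation (\<lambda>w. (\<Sum>k<n. D k w)\<^sup>2) = (\<Sum>j<n. \<Sum>k<n. expectation (\<lambda>w. D j w * D k w))"
    unfolding square by (simp add: Bochner_Integration.integral_sum int)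
  also have "\<dots> = (\<Sum>j<n. \<Sum>k<n. if k = j then expectation (\<lambda>w. D j w * D j w) else 0)"
    using orth' by (intro sum.cong refl) auto
  also have "\<dots> = (\<Sum>j<n. expectation (\<lambda>w. D j w * D j w))"
    by (simp add: sum.delta)
  also have "\<dots> \<le> (\<Sum>j<n. B\<^sup>2)"
    using bnd by (intro sum_mono integral_le_const int AE_I2) (auto simp: abs_le_iff)
  finally have "expectation (\<lambda>w. (\<Sum>k<n. D k w)\<^sup>2) \<le> real n * B\<^sup>2"
    by simp
  moreover have "(\<integral>\<^sup>+ w. ennreal ((\<Sum>k<n. D k w)\<^sup>2) \<partial>M) = ennreal (expectation (\<lambda>w. (\<Sum>k<n. D k w)\<^sup>2))"
  proof (rule nn_integral_eq_integral)
    show "integrable M (\<lambda>w. (\<Sum>k<n. D k w)\<^sup>2)"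
      unfolding square using int by simp
  qed simp
  ultimately show ?thesis
    by (simp add: ennreal_leI)
qed

text \<open>
  Adding the bound \<open>B\<close> to every summand makes the partial sums monotone and shifts the expected limit
  to \<open>B\<close>. This is what allows the interpolation between squares to be shared with the Poisson process.
\<close>

lemma (in prob_space) strong_law_bounded_orthogonal:
  fixes D :: "nat \<Rightarrow> 'a \<Rightarrow> real"
  assumes meas: "\<And>k. D k \<in> borel_measurable M"
    and bounded: "\<And>k w. w \<in> space M \<Longrightarrow> \<bar>D k w\<bar> \<le> B"
    and orth: "\<And>j k. j < k \<Longrightarrow> expectation (\<lambda>w. D j w * D k w) = 0"
  shows "AE w in M. (\<lambda>n. (\<Sum>k<n. D k w) / real n) \<longlonglongrightarrow> 0"
proof -
  define S where "S n w = (\<Sum>k<n. D k w)" for n w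
  have [measurable]: "S n \<in> borel_measurable M" for n
    unfolding S_def using meas by measurable
  have "AE w in M. (\<lambda>k. S (k\<^sup>2) w / (real k)\<^sup>2) \<longlonglongrightarrow> 0"
  proof (rule AE_tendsto_0_along_squares)
    show "(\<integral>\<^sup>+ w. ennreal ((S (k\<^sup>2) w)\<^sup>2) \<partial>M) \<le> ennreal (B\<^sup>2 * (real k)\<^sup>2)" for k
      using second_moment_sum_orthogonal_le[OF assms, where n = "k\<^sup>2"] by (simp add: S_def mult.commute)
  qed auto
  then show ?thesis
  proof (rule AE_mp, intro AE_I2 impI)
    fix w assume w: "w \<in> space M" and lim: "(\<lambda>k. S (k\<^sup>2) w / (real k)\<^sup>2) \<longlonglongrightarrow> 0"
    \<comment> \<open>The partial sums of \<open>D k + B\<close>, extended to a step function of real time.\<close>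
    define a where "a t = S (nat \<lfloor>t\<rfloor>) w + real (nat \<lfloor>t\<rfloor>) * B" for t :: real
    have a_sum: "a t = (\<Sum>k<nat \<lfloor>t\<rfloor>. D k w + B)" for t
      by (simp add: a_def S_def sum.distrib)
    have "mono_on {0..} a"
    proof (rule mono_onI)
      fix s t :: real assume "s \<le> t"
      then have "nat \<lfloor>s\<rfloor> \<le> nat \<lfloor>t\<rfloor>"
        by (intro nat_mono floor_mono)
      moreover have "0 \<le> D k w + B" for k
        using bounded[OF w, of k] by linarith
      ultimately show "a s \<le> a t"
        unfolding a_sum by (intro sum_mono2) auto
    qed
    moreover have "0 \<le> a 0"
      by (simp add: a_sum)
    moreover have "(\<lambda>k::nat. a ((real k)\<^sup>2) / (real k)\<^sup>2) \<longlonglongrightarrow> B"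
    proof (rule Lim_transform_eventually)
      show "(\<lambda>k. S (k\<^sup>2) w / (real k)\<^sup>2 + B) \<longlonglongrightarrow> B"
        using tendsto_add[OF lim tendsto_const[of B]] by simp
      show "\<forall>\<^sub>F k in sequentially. S (k\<^sup>2) w / (real k)\<^sup>2 + B = a ((real k)\<^sup>2) / (real k)\<^sup>2"
        using eventually_gt_at_top[of 0]
        by eventually_elim (simp add: a_def add_divide_distrib flip: of_nat_power)
    qed
    ultimately have "((\<lambda>t. a t / t) \<longlongrightarrow> B) at_top"
      by (rule mono_ratio_tendsto_from_squares)
    then have "(\<lambda>n. a (real n) / real n - B) \<longlonglongrightarrow> B - B"
      by (intro tendsto_diff tendsto_const filterlim_compose[OF _ filterlim_real_sequentially])
    then have "(\<lambda>n. a (real n) / real n - B) \<longlonglongrightarrow> 0"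
      by simp
    then have "(\<lambda>n. S n w / real n) \<longlonglongrightarrow> 0"
      by (rule Lim_transform_eventually)
        (use eventually_gt_at_top[of 0] in \<open>eventually_elim, simp add: a_def add_divide_distrib\<close>)
    then show "(\<lambda>n. (\<Sum>k<n. D k w) / real n) \<longlonglongrightarrow> 0"
      by (simp add: S_def)
  qed
qed

section \<open>A strong law for finite Markov chains\<close>

definition kernel_op :: "'s set \<Rightarrow> ('s \<Rightarrow> 's \<Rightarrow> real) \<Rightarrow> ('s \<Rightarrow> real) \<Rightarrow> 's \<Rightarrow> real" where
  "kernel_op S K g x = (\<Sum>y\<in>S. K x y * g y)"

lemma kernel_op_cong:
  "(\<And>y. y \<in> S \<Longrightarrow> g y = h y) \<Longrightarrow> kernel_op S K g x = kernel_op S K h x"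
  by (simp add: kernel_op_def)

text \<open>
  Duality between the evolution of distributions and that of functions: it translates the convergence
  of distributions in the definition of ergodicity into convergence of powers of the operator.
\<close>

lemma sum_dist_at_eq_kernel_op_power:
  "(\<Sum>y\<in>S. dist_at S K \<nu> n y * g y) = (\<Sum>y\<in>S. pmf \<nu> y * (kernel_op S K ^^ n) g y)"
proof (induction n arbitrary: g)
  case (Suc n)
  have "(\<Sum>y\<in>S. dist_at S K \<nu> (Suc n) y * g y) = (\<Sum>y\<in>S. \<Sum>x\<in>S. dist_at S K \<nu> n x * (K x y * g y))"
    by (simp add: sum_distrib_right mult.assoc)
  also have "\<dots> = (\<Sum>x\<in>S. dist_at S K \<nu> n x * kernel_op S K g x)"
    unfolding kernel_op_def sum_distrib_left by (rule sum.swap)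
  finally show ?case
    by (simp add: Suc.IH funpow_swap1)
qed simp

lemma ergodic_kernel_op_power_tendsto:
  assumes "finite S" "ergodic S K" "stationary S K \<pi>" "x \<in> S"
  shows "(\<lambda>n. (kernel_op S K ^^ n) g x) \<longlonglongrightarrow> (\<Sum>y\<in>S. pmf \<pi> y * g y)"
proof -
  have "(\<lambda>n. dist_at S K (return_pmf x) n y) \<longlonglongrightarrow> pmf \<pi> y" if "y \<in> S" for y
    using assms that unfolding ergodic_def by (metis empty_subsetI insert_subset set_return_pmf)
  then have "(\<lambda>n. \<Sum>y\<in>S. dist_at S K (return_pmf x) n y * g y) \<longlonglongrightarrow> (\<Sum>y\<in>S. pmf \<pi> y * g y)"
    by (intro tendsto_sum tendsto_mult tendsto_const)
  moreover have "(\<Sum>y\<in>S. dist_at S K (return_pmf x) n y * g y) = (kernel_op S K ^^ n) g x" for n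
  proof -
    have "(\<Sum>y\<in>S. dist_at S K (return_pmf x) n y * g y)
        = (\<Sum>y\<in>S. if y = x then (kernel_op S K ^^ n) g y else 0)"
      unfolding sum_dist_at_eq_kernel_op_power by (intro sum.cong) (auto simp: indicator_def)
    then show ?thesis
      using assms by simp
  qed
  ultimately show ?thesis
    by simp
qed

context markov_chain
begin

definition path_event :: "nat \<Rightarrow> (nat \<Rightarrow> 's) \<Rightarrow> 'w set" where
  "path_event n s = {w \<in> space M. \<forall>k\<le>n. X k w = s k}"

lemma X_in_S: "w \<in> space M \<Longrightarrow> X n w \<in> S"
  using measurable_space[OF measurable_X] by auto

lemma sets_path_event:
  assumes "\<And>k. k \<le> n \<Longrightarrow> s k \<in> S"
  shows "path_event n s \<in> events"
proof -
  have "path_event n s = (\<Inter>k\<in>{..n}. X k -` {s k} \<inter> space M)"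
    by (auto simp: path_event_def)
  also have "\<dots> \<in> events"
    using assms by (intro sets.finite_INT measurable_sets[OF measurable_X]) auto
  finally show ?thesis .
qed

lemma measurable_transition:
  assumes "finite S"
  shows "(\<lambda>w. \<phi> (X j w) (X k w)) \<in> borel_measurable M"
proof -
  have "(\<lambda>w. (X j w, X k w)) \<in> measurable M (count_space S \<Otimes>\<^sub>M count_space S)"
    by (intro measurable_Pair measurable_X)
  then have "(\<lambda>w. (X j w, X k w)) \<in> measurable M (count_space (S \<times> S))"
    using assms by (simp add: pair_measure_count_space)
  from measurable_compose[OF this, of "case_prod \<phi>" borel] show ?thesis
    by simp
qed

lemma abs_transition_le:
  fixes \<phi> :: "'s \<Rightarrow> 's \<Rightarrow> real"
  assumes fin: "finite S" and w: "w \<in> space M"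
  shows "\<bar>\<phi> (X j w) (X k w)\<bar> \<le> (\<Sum>x\<in>S. \<Sum>y\<in>S. \<bar>\<phi> x y\<bar>)"
proof -
  have "\<bar>\<phi> (X j w) (X k w)\<bar> \<le> (\<Sum>y\<in>S. \<bar>\<phi> (X j w) y\<bar>)"
    using fin X_in_S[OF w] by (intro member_le_sum[of "X k w"]) auto
  also have "\<dots> \<le> (\<Sum>x\<in>S. \<Sum>y\<in>S. \<bar>\<phi> x y\<bar>)"
    using fin X_in_S[OF w] by (intro member_le_sum[of "X j w"]) (auto intro: sum_nonneg)
  finally show ?thesis .
qed

text \<open>
  The Markov property in conditional-expectation form: given a history that ends in \<open>s n\<close>, a function
  of the next transition is averaged with the row \<open>K (s n)\<close>. Since histories are finite and \<open>S\<close> is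
  finite, elementary sums suffice.
\<close>

lemma integral_path_event_transition:
  assumes fin: "finite S" and s: "\<And>k. k \<le> n \<Longrightarrow> s k \<in> S"
  shows "expectation (\<lambda>w. indicator (path_event n s) w * \<phi> (X n w) (X (Suc n) w))
    = prob (path_event n s) * (\<Sum>y\<in>S. K (s n) y * \<phi> (s n) y)"
proof -
  let ?s = "\<lambda>y. s(Suc n := y)"
  have in_S: "?s y k \<in> S" if "y \<in> S" "k \<le> Suc n" for y k
    using that s by (auto simp: le_Suc_eq)
  have ev: "path_event (Suc n) (?s y) \<in> events" if "y \<in> S" for y
    using in_S[OF that] by (intro sets_path_event)
  \<comment> \<open>The history is split according to the value of the next state.\<close>
  have split: "indicator (path_event n s) w * \<phi> (X n w) (X (Suc n) w)
      = (\<Sum>y\<in>S. indicator (path_event (Suc n) (?s y)) w * \<phi> (s n) y)" (is "?l = ?r")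
    if "w \<in> space M" for w
  proof -
    have "?r = (\<Sum>y\<in>S. if y = X (Suc n) w then ?l else 0)"
      using that by (intro sum.cong refl) (auto simp: path_event_def indicator_def le_Suc_eq)
    then show ?thesis
      using fin X_in_S[OF that] by simp
  qed
  have "prob (path_event (Suc n) (?s y)) = prob (path_event n s) * K (s n) y" if "y \<in> S" for y
  proof -
    have "path_event n (?s y) = path_event n s"
      by (auto simp: path_event_def)
    then show ?thesis
      using transition[of n "?s y"] in_S[OF that] by (simp add: path_event_def)
  qed
  moreover have "expectation (\<lambda>w. indicator (path_event n s) w * \<phi> (X n w) (X (Suc n) w))
      = expectation (\<lambda>w. \<Sum>y\<in>S. indicator (path_event (Suc n) (?s y)) w * \<phi> (s n) y)"
    by (intro Bochner_Integration.integral_cong refl split)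
  moreover have "\<dots> = (\<Sum>y\<in>S. prob (path_event (Suc n) (?s y)) * \<phi> (s n) y)"
    using ev by (subst Bochner_Integration.integral_sum) (auto simp: emeasure_eq_measure)
  ultimately show ?thesis
    by (simp add: sum_distrib_left mult.assoc)
qed

text \<open>
  Conditioning on the history up to time \<open>k\<close> fixes the earlier factor, because \<open>j + 1 \<le> k\<close>, while the
  later factor has conditional mean 0.
\<close>

lemma expectation_transition_products_eq_0:
  assumes fin: "finite S" and centred: "\<And>x. x \<in> S \<Longrightarrow> (\<Sum>y\<in>S. K x y * \<phi> x y) = 0" and "j < k"
  shows "expectation (\<lambda>w. \<phi> (X j w) (X (Suc j) w) * \<phi> (X k w) (X (Suc k) w)) = (0 :: real)"
proof -
  let ?paths = "PiE {..k} (\<lambda>_. S)"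
  let ?D = "\<lambda>k w. \<phi> (X k w) (X (Suc k) w)"
  have fin_paths: "finite ?paths"
    using fin by (intro finite_PiE) auto
  have in_S: "s i \<in> S" if "s \<in> ?paths" "i \<le> k" for s i
    using that by (auto simp: PiE_def)
  have split: "?D j w * ?D k w = (\<Sum>s\<in>?paths. \<phi> (s j) (s (Suc j)) * (indicator (path_event k s) w * ?D k w))"
    (is "_ = ?r") if w: "w \<in> space M" for w
  proof -
    define s' where "s' = restrict (\<lambda>i. X i w) {..k}"
    have s': "s' \<in> ?paths" "s' j = X j w" "s' (Suc j) = X (Suc j) w"
      using X_in_S[OF w] \<open>j < k\<close> by (auto simp: s'_def)
    have "w \<in> path_event k s \<longleftrightarrow> s = s'" if "s \<in> ?paths" for s
    proof
      assume "w \<in> path_event k s"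
      then show "s = s'"
        using that s'(1) by (intro PiE_ext) (auto simp: path_event_def s'_def)
    qed (use w in \<open>auto simp: path_event_def s'_def\<close>)
    then have "?r = (\<Sum>s\<in>?paths. if s = s' then ?D j w * ?D k w else 0)"
      using s' by (intro sum.cong refl) (auto simp: indicator_def)
    then show ?thesis
      using fin_paths s' by simp
  qed
  have int: "integrable M (\<lambda>w. indicator (path_event k s) w * ?D k w)" if "s \<in> ?paths" for s
  proof -
    have "integrable M (?D k)"
      using abs_transition_le[OF fin, of _ \<phi>]
      by (intro integrable_const_bound[where B = "\<Sum>x\<in>S. \<Sum>y\<in>S. \<bar>\<phi> x y\<bar>"] measurable_transition fin AE_I2) auto
    then show ?thesis
      using sets_path_event[OF in_S[OF that]] by (intro integrable_real_mult_indicator[where f = "?D k", simplified mult.commute])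
  qed
  have "expectation (\<lambda>w. ?D j w * ?D k w)
      = expectation (\<lambda>w. \<Sum>s\<in>?paths. \<phi> (s j) (s (Suc j)) * (indicator (path_event k s) w * ?D k w))"
    by (intro Bochner_Integration.integral_cong refl split)
  also have "\<dots> = (\<Sum>s\<in>?paths. \<phi> (s j) (s (Suc j)) * expectation (\<lambda>w. indicator (path_event k s) w * ?D k w))"
    using int by (subst Bochner_Integration.integral_sum) auto
  also have "\<dots> = 0"
    using in_S by (intro sum.neutral ballI) (simp add: integral_path_event_transition fin centred)
  finally show ?thesis .
qed

lemma strong_law_centred_transitions:
  assumes fin: "finite S" and centred: "\<And>x. x \<in> S \<Longrightarrow> (\<Sum>y\<in>S. K x y * \<phi> x y) = (0 :: real)"
  shows "AE w in M. (\<lambda>n. (\<Sum>k<n. \<phi> (X k w) (X (Suc k) w)) / real n) \<longlonglongrightarrow> 0"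
  by (rule strong_law_bounded_orthogonal)
    (rule measurable_transition[OF fin] abs_transition_le[OF fin]
      expectation_transition_products_eq_0[OF assms]; assumption)+

text \<open>
  The function \<open>\<phi> m\<close> below is \<open>\<Phi>\<close> corrected by the coboundary of \<open>h m = f + \<dots> + T\<^bsup>m-1\<^esup> f\<close> and by
  \<open>T\<^sup>m f\<close>, where \<open>T\<close> is the operator of \<open>K\<close>. It has row means 0 because \<open>T (h m) - h m = T\<^sup>m f - f\<close>.
\<close>

lemma strong_law_transitions:
  fixes \<Phi> :: "'s \<Rightarrow> 's \<Rightarrow> real" and f :: "'s \<Rightarrow> real"
  assumes fin: "finite S" and stochastic: "\<And>x. x \<in> S \<Longrightarrow> (\<Sum>y\<in>S. K x y) = 1"
    and f: "\<And>x. x \<in> S \<Longrightarrow> (\<Sum>y\<in>S. K x y * \<Phi> x y) = f x"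
    and lim: "\<And>x. x \<in> S \<Longrightarrow> (\<lambda>m. (kernel_op S K ^^ m) f x) \<longlonglongrightarrow> \<mu>"
  shows "AE w in M. (\<lambda>n. (\<Sum>k<n. \<Phi> (X k w) (X (Suc k) w)) / real n) \<longlonglongrightarrow> \<mu>"
proof -
  define g where "g m = (kernel_op S K ^^ m) f" for m
  define h where "h m x = (\<Sum>k<m. g k x)" for m x
  define \<phi> where "\<phi> m x y = \<Phi> x y + h m y - h m x - g m x" for m x y
  have "(\<Sum>y\<in>S. K x y * \<phi> m x y) = 0" if x: "x \<in> S" for m x
  proof -
    have "(\<Sum>y\<in>S. K x y * h m y) = (\<Sum>k<m. g (Suc k) x)"
      unfolding h_def sum_distrib_left by (subst sum.swap) (simp add: g_def kernel_op_def)
    moreover have "h m x + g m x = g 0 x + (\<Sum>k<m. g (Suc k) x)"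
      unfolding h_def by (rule trans[OF sum.lessThan_Suc[symmetric] sum.lessThan_Suc_shift])
    moreover have "(\<Sum>y\<in>S. K x y * \<phi> m x y)
        = (\<Sum>y\<in>S. K x y * \<Phi> x y) + (\<Sum>y\<in>S. K x y * h m y) - (\<Sum>y\<in>S. K x y) * (h m x + g m x)"
      by (simp add: \<phi>_def algebra_simps sum.distrib sum_subtractf sum_distrib_left)
    ultimately show ?thesis
      using x by (simp add: f stochastic g_def)
  qed
  then have "AE w in M. \<forall>m. (\<lambda>n. (\<Sum>k<n. \<phi> m (X k w) (X (Suc k) w)) / real n) \<longlonglongrightarrow> 0"
    unfolding AE_all_countable by (intro allI strong_law_centred_transitions fin)
  then show ?thesis
  proof (rule AE_mp, intro AE_I2 impI)
    fix w
    assume w: "w \<in> space M"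
      and "\<forall>m. (\<lambda>n. (\<Sum>k<n. \<phi> m (X k w) (X (Suc k) w)) / real n) \<longlonglongrightarrow> 0"
    then have lim0: "(\<lambda>n. (\<Sum>k<n. \<phi> m (X k w) (X (Suc k) w)) / real n) \<longlonglongrightarrow> 0" for m
      by blast
    let ?S = "\<lambda>n. \<Sum>k<n. \<Phi> (X k w) (X (Suc k) w)"
    show "(\<lambda>n. ?S n / real n) \<longlonglongrightarrow> \<mu>"
    proof (rule tendstoI)
      fix e :: real assume e: "0 < e"
      have "\<forall>\<^sub>F m in sequentially. \<forall>x\<in>S. \<bar>g m x - \<mu>\<bar> < e / 2"
      proof (intro eventually_ball_finite ballI fin)
        fix x assume "x \<in> S"
        then show "\<forall>\<^sub>F m in sequentially. \<bar>g m x - \<mu>\<bar> < e / 2"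
          using tendstoD[OF lim, of x "e / 2"] e by (simp add: g_def dist_real_def)
      qed
      then obtain m where m: "\<And>x. x \<in> S \<Longrightarrow> \<bar>g m x - \<mu>\<bar> < e / 2"
        by (auto simp: eventually_sequentially)
      define H where "H = (\<Sum>x\<in>S. \<bar>h m x\<bar>)"
      have H: "\<bar>h m (X k w)\<bar> \<le> H" for k
        unfolding H_def using fin X_in_S[OF w] by (intro member_le_sum) auto
      let ?E = "\<lambda>n. \<bar>(\<Sum>k<n. \<phi> m (X k w) (X (Suc k) w)) / real n\<bar> + 2 * H / real n"
      have "?E \<longlonglongrightarrow> \<bar>0\<bar> + 0"
        by (intro tendsto_add tendsto_rabs lim0 lim_const_over_n)
      then have "\<forall>\<^sub>F n in sequentially. ?E n < e / 2"
        using e by (intro order_tendstoD) auto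
      then show "\<forall>\<^sub>F n in sequentially. dist (?S n / real n) \<mu> < e"
        using eventually_gt_at_top[of 0]
      proof eventually_elim
        case (elim n)
        have "?S n - real n * \<mu> = (\<Sum>k<n. \<phi> m (X k w) (X (Suc k) w) + (g m (X k w) - \<mu>)
            - (h m (X (Suc k) w) - h m (X k w)))"
          by (simp add: \<phi>_def sum.distrib sum_subtractf)
        also have "\<dots> = (\<Sum>k<n. \<phi> m (X k w) (X (Suc k) w)) + (\<Sum>k<n. g m (X k w) - \<mu>)
            - (h m (X n w) - h m (X 0 w))"
          using sum_lessThan_telescope[of "\<lambda>k. h m (X k w)" n]
          by (simp only: sum.distrib sum_subtractf)
        finally have "\<bar>?S n - real n * \<mu>\<bar> \<le> \<bar>\<Sum>k<n. \<phi> m (X k w) (X (Suc k) w)\<bar>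
            + \<bar>\<Sum>k<n. g m (X k w) - \<mu>\<bar> + 2 * H"
          using H[of n] H[of 0] by linarith
        moreover have "\<bar>\<Sum>k<n. g m (X k w) - \<mu>\<bar> \<le> (\<Sum>k<n. e / 2)"
          using m X_in_S[OF w] by (intro order_trans[OF sum_abs] sum_mono) (auto intro: less_imp_le)
        ultimately have "\<bar>?S n - real n * \<mu>\<bar> / real n \<le> (\<bar>\<Sum>k<n. \<phi> m (X k w) (X (Suc k) w)\<bar>
            + real n * (e / 2) + 2 * H) / real n"
          by (intro divide_right_mono) auto
        also have "\<dots> = ?E n + e / 2"
          using elim by (simp add: add_divide_distrib)
        also have "\<dots> < e"
          using elim(1) by linarith
        finally have "\<bar>(?S n - real n * \<mu>) / real n\<bar> < e"
          by simp
        then show ?case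
          using elim by (simp add: dist_real_def diff_divide_distrib)
      qed
    qed
  qed
qed

end

section \<open>The growth rate of a Poisson process\<close>

text \<open>
  The three series with weights 1, \<open>n\<close> and \<open>n\<^sup>2\<close> are all obtained from the exponential series through
  \<open>(n + 1) r\<^bsup>n+1\<^esup> / (n + 1)! = r r\<^sup>n / n!\<close>.
\<close>

lemma poisson_variance:
  assumes "0 < r"
  shows "(\<integral>\<^sup>+ n. ennreal ((real n - r)\<^sup>2) \<partial>measure_pmf (poisson_pmf r)) = ennreal r"
proof -
  let ?a = "\<lambda>n. r ^ n / fact n"
  have exp: "?a sums exp r"
    using exp_converges[of r] by (simp add: divide_inverse mult.commute)
  have shift: "real (Suc n) * ?a (Suc n) = r * ?a n" for n
    by (simp add: divide_simps)
  have "(\<lambda>n. real (Suc n) * ?a (Suc n)) sums (r * exp r)"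
    unfolding shift by (intro sums_mult exp)
  then have first: "(\<lambda>n. real n * ?a n) sums (r * exp r)"
    by (subst (asm) sums_Suc_iff) simp
  have "real (Suc n) * (real (Suc n) * ?a (Suc n)) = r * (real n * ?a n) + r * ?a n" for n
    unfolding shift by (simp add: algebra_simps add_divide_distrib)
  then have "(\<lambda>n. real (Suc n) * (real (Suc n) * ?a (Suc n))) sums (r * (r * exp r) + r * exp r)"
    using sums_add[OF sums_mult[OF first, of r] sums_mult[OF exp, of r]] by simp
  then have second: "(\<lambda>n. real n * (real n * ?a n)) sums (r * (r * exp r) + r * exp r)"
    by (subst (asm) sums_Suc_iff) simp
  have "(\<lambda>n. exp (- r) * (real n * (real n * ?a n) - 2 * r * (real n * ?a n) + r\<^sup>2 * ?a n)) sums
      (exp (- r) * ((r * (r * exp r) + r * exp r) - 2 * r * (r * exp r) + r\<^sup>2 * exp r))"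
    by (intro sums_mult sums_add sums_diff first second exp)
  also have "(\<lambda>n. exp (- r) * (real n * (real n * ?a n) - 2 * r * (real n * ?a n) + r\<^sup>2 * ?a n))
      = (\<lambda>n. pmf (poisson_pmf r) n * (real n - r)\<^sup>2)"
    using assms by (simp add: fun_eq_iff field_simps power2_eq_square)
  also have "exp (- r) * ((r * (r * exp r) + r * exp r) - 2 * r * (r * exp r) + r\<^sup>2 * exp r) = r"
    by (simp add: algebra_simps power2_eq_square exp_minus)
  finally have sums: "(\<lambda>n. pmf (poisson_pmf r) n * (real n - r)\<^sup>2) sums r" .
  have "(\<integral>\<^sup>+ n. ennreal ((real n - r)\<^sup>2) \<partial>measure_pmf (poisson_pmf r))
      = (\<Sum>n. ennreal (pmf (poisson_pmf r) n * (real n - r)\<^sup>2))"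
    by (simp add: nn_integral_measure_pmf nn_integral_count_space_nat ennreal_mult)
  also have "\<dots> = ennreal r"
    using sums by (subst suminf_ennreal2) (auto simp: sums_iff)
  finally show ?thesis .
qed

lemma (in poisson_process) second_moment_centred:
  assumes "0 < rate * t" "0 < t"
  shows "(\<integral>\<^sup>+ w. ennreal ((real (C t w) - rate * t)\<^sup>2) \<partial>M) = ennreal (rate * t)"
proof -
  have [measurable]: "C t \<in> measurable M (count_space UNIV)" "C 0 \<in> measurable M (count_space UNIV)"
    using measurable_C assms by auto
  have "(\<integral>\<^sup>+ w. ennreal ((real (C t w) - rate * t)\<^sup>2) \<partial>M)
      = (\<integral>\<^sup>+ w. ennreal ((real (C t w - C 0 w) - rate * t)\<^sup>2) \<partial>M)"
    using counting_paths by (intro nn_integral_cong_AE) auto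
  also have "\<dots> = (\<integral>\<^sup>+ n. ennreal ((real n - rate * t)\<^sup>2)
      \<partial>distr M (count_space UNIV) (\<lambda>w. C t w - C 0 w))"
    by (subst nn_integral_distr) auto
  also have "\<dots> = ennreal (rate * t)"
    using assms increments[of 0 t] by (simp add: poisson_variance)
  finally show ?thesis .
qed

lemma (in poisson_process) growth_rate:
  assumes "0 < rate"
  shows "AE w in M. ((\<lambda>t. real (C t w) / t) \<longlongrightarrow> rate) at_top"
proof -
  define Y where "Y k w = real (C ((real k)\<^sup>2) w) - rate * (real k)\<^sup>2" for k w
  have meas_C [measurable]: "C ((real k)\<^sup>2) \<in> measurable M (count_space UNIV)" for k
    by (intro measurable_C) simp
  have C0: "AE w in M. C 0 w = 0"
    using counting_paths by auto
  have "AE w in M. (\<lambda>k. Y k w / (real k)\<^sup>2) \<longlonglongrightarrow> 0"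
  proof (rule AE_tendsto_0_along_squares)
    show "Y k \<in> borel_measurable M" for k
      unfolding Y_def by measurable
    show "(\<integral>\<^sup>+ w. ennreal ((Y k w)\<^sup>2) \<partial>M) \<le> ennreal (rate * (real k)\<^sup>2)" for k
    proof (cases "k = 0")
      case True
      \<comment> \<open>There is no increment over an interval of length 0; here \<open>C 0 = 0\<close> almost surely is used.\<close>
      have "(\<integral>\<^sup>+ w. ennreal ((Y k w)\<^sup>2) \<partial>M) = (\<integral>\<^sup>+ w. 0 \<partial>M)"
        using C0 True by (intro nn_integral_cong_AE) (auto simp: Y_def)
      then show ?thesis
        by simp
    qed (use assms in \<open>simp add: Y_def second_moment_centred\<close>)
  qed (use assms in simp)
  with counting_paths show ?thesis
  proof eventually_elim
    case (elim w)
    have "(\<lambda>k. Y k w / (real k)\<^sup>2 + rate) \<longlonglongrightarrow> rate"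
      using tendsto_add[OF elim(2) tendsto_const[of rate]] by simp
    then have "(\<lambda>k::nat. real (C ((real k)\<^sup>2) w) / (real k)\<^sup>2) \<longlonglongrightarrow> rate"
      by (rule Lim_transform_eventually)
        (use eventually_gt_at_top[of 0] in \<open>eventually_elim, simp add: Y_def diff_divide_distrib\<close>)
    then show ?case
      using elim by (intro mono_ratio_tendsto_from_squares) (auto simp: mono_on_def)
  qed
qed

section \<open>The ensemble of players\<close>

text \<open>Heads raises a component to 1 and tails lowers it to 0, so a 0 flips on heads and a 1 on tails.\<close>

definition flip_prob :: "nat \<Rightarrow> (nat \<Rightarrow> real) \<Rightarrow> config \<Rightarrow> nat \<Rightarrow> real" where
  "flip_prob N p x i = (if x i = 0 then p (nbhd N x i) else 1 - p (nbhd N x i))"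

definition player_average :: "nat \<Rightarrow> (config \<times> nat \<Rightarrow> real) \<Rightarrow> config \<Rightarrow> real" where
  "player_average N g x = 1 / real N * (\<Sum>i=1..N. g (x, i))"

lemma finite_configs: "finite (configs N)"
  unfolding configs_def by (intro finite_PiE) auto

lemma configs_values: "x \<in> configs N \<Longrightarrow> i \<in> {1..N} \<Longrightarrow> x i = 0 \<or> x i = 1"
  by (auto simp: configs_def PiE_def Pi_def)

lemma flip_in_configs: "x \<in> configs N \<Longrightarrow> i \<in> {1..N} \<Longrightarrow> flip x i \<in> configs N"
  by (auto simp: configs_def flip_def PiE_def Pi_def extensional_def)

lemma flip_neq: "x \<in> configs N \<Longrightarrow> i \<in> {1..N} \<Longrightarrow> flip x i \<noteq> x"
  using configs_values[of x N i] by (auto simp: flip_def fun_eq_iff)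

text \<open>
  The next player is uniform and independent of the new configuration, so a function on the enlarged
  state space enters only through its average over the players.
\<close>

lemma sum_P_star:
  assumes x: "x \<in> configs N" and i: "i \<in> {1..N}"
  shows "(\<Sum>z\<in>states_star N. P_star N p (x, i) z * G z) =
    flip_prob N p x i * player_average N G (flip x i) + (1 - flip_prob N p x i) * player_average N G x"
proof -
  let ?a = "flip_prob N p x i"
  let ?A = "player_average N G"
  have "(\<Sum>j=1..N. P_star N p (x, i) (y, j) * G (y, j)) =
      (if y = flip x i then ?a * ?A y else 0) + (if y = x then (1 - ?a) * ?A y else 0)" for y
    using flip_neq[OF x i]
    by (auto simp: P_star_def flip_prob_def player_average_def sum_distrib_left sum_divide_distrib mult.assoc)
  then have "(\<Sum>z\<in>states_star N. P_star N p (x, i) z * G z) =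
      (\<Sum>y\<in>configs N. (if y = flip x i then ?a * ?A y else 0) + (if y = x then (1 - ?a) * ?A y else 0))"
    unfolding states_star_def by (subst sum.cartesian_product') simp
  then show ?thesis
    using flip_in_configs[OF x i] x finite_configs[of N] by (simp add: sum.distrib)
qed

text \<open>
  The chain of configurations first draws a uniform player and then lets that player flip a coin; the
  diagonal entry collects the players whose component does not change.
\<close>

lemma sum_P:
  assumes x: "x \<in> configs N"
  shows "(\<Sum>y\<in>configs N. P N p x y * G y) = 1 / real N * (\<Sum>i=1..N.
    flip_prob N p x i * G (flip x i) + (1 - flip_prob N p x i) * G x)"
proof -
  let ?a = "\<lambda>i. 1 / real N * flip_prob N p x i"
  have off: "(\<Sum>i\<in>{i\<in>{1..N}. y = flip x i}. ?a i) * G y = (\<Sum>i=1..N. if y = flip x i then ?a i * G y else 0)" for y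
    by (simp add: sum.If_cases sum_distrib_right Int_def)
  have no_flip: "(\<Sum>i=1..N. if x = flip x i then ?a i * G x else 0) = 0"
    using flip_neq[OF x] by (intro sum.neutral ballI if_not_P) metis
  have diag: "(\<Sum>i\<in>{i\<in>{1..N}. x i = 0}. 1 - p (nbhd N x i)) + (\<Sum>i\<in>{i\<in>{1..N}. x i = 1}. p (nbhd N x i))
      = (\<Sum>i=1..N. 1 - flip_prob N p x i)" (is "?zeros + ?ones = _")
  proof -
    have "?zeros + ?ones = (\<Sum>i=1..N. (if x i = 0 then 1 - p (nbhd N x i) else 0)
        + (if x i = 1 then p (nbhd N x i) else 0))"
      by (simp add: sum.distrib sum.If_cases Int_def)
    also have "\<dots> = (\<Sum>i=1..N. 1 - flip_prob N p x i)"
      by (intro sum.cong refl) (use configs_values[OF x] in \<open>fastforce simp: flip_prob_def\<close>)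
    finally show ?thesis .
  qed
  have "P N p x y * G y = (\<Sum>i=1..N. if y = flip x i then ?a i * G y else 0) +
      (if y = x then 1 / real N * (\<Sum>i=1..N. 1 - flip_prob N p x i) * G y else 0)" for y
  proof (cases "y = x")
    case True
    show ?thesis
      unfolding True no_flip by (simp only: P_def simp_thms if_True diag add_0)
  next
    case False
    then show ?thesis
      using off[of y] by (simp add: P_def flip_prob_def)
  qed
  then have "(\<Sum>y\<in>configs N. P N p x y * G y) =
      (\<Sum>y\<in>configs N. \<Sum>i=1..N. if y = flip x i then ?a i * G y else 0) +
      1 / real N * (\<Sum>i=1..N. 1 - flip_prob N p x i) * G x"
    using x finite_configs[of N] by (simp add: sum.distrib)
  also have "(\<Sum>y\<in>configs N. \<Sum>i=1..N. if y = flip x i then ?a i * G y else 0)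
      = (\<Sum>i=1..N. \<Sum>y\<in>configs N. if y = flip x i then ?a i * G y else 0)"
    by (rule sum.swap)
  also have "(\<Sum>i=1..N. \<Sum>y\<in>configs N. if y = flip x i then ?a i * G y else 0)
      = (\<Sum>i=1..N. ?a i * G (flip x i))"
    using flip_in_configs[OF x] finite_configs[of N] by (intro sum.cong refl) simp
  finally show ?thesis
    by (simp only: sum.distrib distrib_left sum_distrib_left sum_distrib_right mult.assoc)
qed

text \<open>
  Out of \<open>(x, i)\<close> the enlarged chain performs the coin flip of player \<open>i\<close> and then averages over the next
  player. Averaging over \<open>i\<close> as well reproduces the uniform draw of a player in \<open>P\<close>.
\<close>

lemma player_average_kernel_op:
  assumes "x \<in> configs N"
  shows "player_average N (kernel_op (states_star N) (P_star N p) g) x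
    = kernel_op (configs N) (P N p) (player_average N g) x"
  unfolding kernel_op_def sum_P[OF assms]
  unfolding player_average_def[of _ "\<lambda>x. \<Sum>y\<in>_. _ x y"]
  using sum_P_star[OF assms] by simp

lemma player_average_kernel_op_power:
  assumes "x \<in> configs N"
  shows "player_average N ((kernel_op (states_star N) (P_star N p) ^^ m) g) x
    = (kernel_op (configs N) (P N p) ^^ m) (player_average N g) x"
  using assms
proof (induction m arbitrary: x)
  case (Suc m)
  then show ?case
    by (simp add: player_average_kernel_op cong: kernel_op_cong)
qed simp

text \<open>
  One step out of \<open>(x, i)\<close> yields a combination, with coefficients of sum 1, of player
  averages at \<open>x\<close> and at \<open>flip x i\<close>. The averages evolve under \<open>P\<close> and so converge, whichever \<open>x\<close> and
  \<open>i\<close> are.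
\<close>

lemma kernel_op_P_star_power_tendsto:
  assumes "ergodic (configs N) (P N p)" "stationary (configs N) (P N p) \<pi>" "z \<in> states_star N"
  shows "(\<lambda>m. (kernel_op (states_star N) (P_star N p) ^^ m) g z)
    \<longlonglongrightarrow> (\<Sum>x\<in>configs N. pmf \<pi> x * player_average N g x)" (is "_ \<longlonglongrightarrow> ?\<mu>")
proof -
  let ?T = "kernel_op (states_star N) (P_star N p)"
  obtain x i where z: "z = (x, i)" "x \<in> configs N" "i \<in> {1..N}"
    using assms(3) by (auto simp: states_star_def)
  let ?a = "flip_prob N p x i"
  have lim: "(\<lambda>m. player_average N ((?T ^^ m) g) y) \<longlonglongrightarrow> ?\<mu>" if "y \<in> configs N" for y
    using ergodic_kernel_op_power_tendsto[OF finite_configs assms(1,2) that] that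
    by (simp add: player_average_kernel_op_power)
  have "(\<lambda>m. ?a * player_average N ((?T ^^ m) g) (flip x i) + (1 - ?a) * player_average N ((?T ^^ m) g) x)
      \<longlonglongrightarrow> ?a * ?\<mu> + (1 - ?a) * ?\<mu>"
    by (intro tendsto_intros lim z flip_in_configs)
  then have "(\<lambda>m. (?T ^^ Suc m) g z) \<longlonglongrightarrow> ?\<mu>"
    using z by (simp add: kernel_op_def[of _ _ "(?T ^^ _) g"] sum_P_star algebra_simps)
  then show ?thesis
    by (rule LIMSEQ_imp_Suc)
qed

text \<open>
  Player \<open>i\<close> wins exactly if the new component is 1, which happens on heads whatever the old component
  was. So \<open>x i\<close> drops out.
\<close>

lemma expected_profit:
  assumes "x \<in> configs N" "i \<in> {1..N}"
  shows "(\<Sum>z\<in>states_star N. P_star N p (x, i) z * profit (x, i) z)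
    = p (nbhd N x i) - (1 - p (nbhd N x i))"
  using configs_values[OF assms] assms(2) unfolding sum_P_star[OF assms]
  by (auto simp: player_average_def profit_def flip_prob_def flip_def)

theorem theorem8:
  fixes N :: nat and p :: "nat \<Rightarrow> real" and \<pi> :: "config pmf"
    and M :: "'w measure" and X :: "nat \<Rightarrow> 'w \<Rightarrow> config \<times> nat" and C :: "real \<Rightarrow> 'w \<Rightarrow> nat"
  assumes "N \<ge> 3"
    and "\<forall>m\<in>{0..3}. p m \<in> {0..1}"
    and "ergodic (configs N) (P N p)"
    and "stationary (configs N) (P N p) \<pi>"
    and "uniformized_chain M (states_star N) (P_star N p) X C"
  shows "AE w in M.
    ((\<lambda>t. inverse t * cum_profit_ct X C t w) \<longlongrightarrow>
      1 / real N * (\<Sum>x\<in>configs N. pmf \<pi> x *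
        (\<Sum>i=1..N. p (nbhd N x i) - (1 - p (nbhd N x i))))) at_top"
    (is "AE w in M. (_ \<longlongrightarrow> ?\<mu>) at_top")
proof -
  interpret uniformized_chain M "states_star N" "P_star N p" X C
    by fact
  define f where "f = (\<lambda>(x, i). p (nbhd N x i) - (1 - p (nbhd N x i)))"
  have \<mu>: "?\<mu> = (\<Sum>x\<in>configs N. pmf \<pi> x * player_average N f x)"
    by (simp add: player_average_def f_def sum_distrib_left algebra_simps)
  have "AE w in M. (\<lambda>n. (\<Sum>k<n. profit (X k w) (X (Suc k) w)) / real n) \<longlonglongrightarrow> ?\<mu>"
  proof (rule strong_law_transitions)
    show "finite (states_star N)"
      by (simp add: states_star_def finite_configs)
    fix z assume z: "z \<in> states_star N"
    show "(\<Sum>y\<in>states_star N. P_star N p z y) = 1"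
      using z sum_P_star[of "fst z" N "snd z" p "\<lambda>_. 1"] by (auto simp: states_star_def player_average_def)
    show "(\<Sum>y\<in>states_star N. P_star N p z y * profit z y) = f z"
      using z expected_profit[of "fst z" N "snd z" p] by (auto simp: states_star_def f_def)
    show "(\<lambda>m. (kernel_op (states_star N) (P_star N p) ^^ m) f z) \<longlonglongrightarrow> ?\<mu>"
      unfolding \<mu> by (intro kernel_op_P_star_power_tendsto assms z)
  qed
  moreover have "AE w in M. ((\<lambda>t. real (C t w) / t) \<longlongrightarrow> 1) at_top"
    by (rule growth_rate) simp
  ultimately show ?thesis
  proof eventually_elim
    case (elim w)
    let ?avg = "\<lambda>n. cum_profit X n w / real n"
    \<comment> \<open>The number of jumps diverges because its growth rate is positive.\<close>
    have growth: "((\<lambda>t. real (C t w) / t) \<longlongrightarrow> 1) at_top"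
      using elim by simp
    have "filterlim (\<lambda>t. real (C t w) / t * t) at_top at_top"
      by (rule filterlim_tendsto_pos_mult_at_top[OF growth]) (auto intro: filterlim_ident)
    moreover have cancel: "\<forall>\<^sub>F t in at_top. real (C t w) / t * t = real (C t w)"
      using eventually_gt_at_top[of 0] by eventually_elim simp
    ultimately have "filterlim (\<lambda>t. real (C t w)) at_top at_top"
      by (simp only: filterlim_cong[OF refl refl cancel])
    then have jumps: "filterlim (\<lambda>t. C t w) sequentially at_top"
      by (subst (asm) filterlim_sequentially_iff_filterlim_real[symmetric])
    have "?avg \<longlonglongrightarrow> ?\<mu>"
      using elim by (simp add: cum_profit_def)
    then have "((\<lambda>t. ?avg (C t w) * (real (C t w) / t)) \<longlongrightarrow> ?\<mu> * 1) at_top"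
      by (intro tendsto_mult growth filterlim_compose[OF _ jumps])
    then have "((\<lambda>t. ?avg (C t w) * (real (C t w) / t)) \<longlongrightarrow> ?\<mu>) at_top"
      by simp
    then show ?case
    proof (rule Lim_transform_eventually)
      have "\<forall>\<^sub>F t in at_top. 0 < C t w"
        by (rule eventually_compose_filterlim[OF eventually_gt_at_top jumps])
      then show "\<forall>\<^sub>F t in at_top. ?avg (C t w) * (real (C t w) / t) = inverse t * cum_profit_ct X C t w"
        by eventually_elim (simp add: cum_profit_ct_def divide_inverse)
    qed
  qed
qed

end
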